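(* Let $t_0>0$, $\alpha>0$, $\delta>0$, $\sigma>0$, $s\in[0,1]$, and assume $\alpha\delta>1$ if $s=0$, and $\delta\le 1$ if $s=1$. Let $\beta:[t_0,+\infty)\to(0,+\infty)$ be continuously differentiable with $$t^s\dot\beta(t)\le\Big(\frac1\delta-s t^{s-1}\Big)\beta(t)\quad\text{for all }t\ge t_0,$$ and let $\epsilon:[t_0,+\infty)\to\mathcal H_1$ be an integrable function with $\int_{t_0}^{+\infty}t^{s/2}\|\epsilon(t)\|\,dt<+\infty$. Let $(x(t),\lambda(t))$ be a global solution on $[t_0,+\infty)$ of $$\begin{cases}\ddot x(t)+\alpha\dot x(t)=-\beta(t)\big(\nabla f(x(t))+A^T(\lambda(t)+\delta t^s\dot\lambda(t))+\sigma A^T(Ax(t)-b)\big)+\epsilon(t),\\ \ddot\lambda(t)+\alpha\dot\lambda(t)=\beta(t)\big(A(x(t)+\delta t^s\dot x(t))-b\big),\end{cases}$$ and let $(x^*,\lambda^* )\in\Omega$. Then $(x(t),\lambda(t))$ is bounded on $[t_0,+\infty)$, and: (i) $\int_{t_0}^{+\infty}\big((\frac1\delta-st^{s-1})\beta(t)-t^s\dot\beta(t)\big)\big(\mathcal L^\sigma(x(t),\lambda^* )-\mathcal L^\sigma(x^*,\lambda^* )\big)\,dt<+\infty$. (ii) $\int_{t_0}^{+\infty}t^s(\|\dot x(t)\|^2+\|\dot\lambda(t)\|^2)\,dt<+\infty$ and $\int_{t_0}^{+\infty}\beta(t)\|Ax(t)-b\|^2\,dt<+\infty$. (iii) $\|\dot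 x(t)\|+\|\dot\lambda(t)\|=\mathcal O\big(\frac1{t^{s/2}}\big)$. (iv) If $\lim_{t\to+\infty}t^s\beta(t)=+\infty$, then $$\mathcal L(x(t),\lambda^* )-\mathcal L(x^*,\lambda^* )=\mathcal O\Big(\frac1{t^s\beta(t)}\Big),\qquad \|Ax(t)-b\|=\mathcal O\Big(\frac1{t^{s/2}\sqrt{\beta(t)}}\Big).$$
   Context: $\mathcal H_1,\mathcal H_2$ are real Hilbert spaces, $A:\mathcal H_1\to\mathcal H_2$ is a continuous linear operator with adjoint $A^T$, $b\in\mathcal H_2$, and $f:\mathcal H_1\to\mathbb R$ is convex and continuously differentiable. The Lagrangian is $\mathcal L(x,\lambda)=f(x)+\langle\lambda,Ax-b\rangle$ and the augmented Lagrangian is $\mathcal L^\sigma(x,\lambda)=\mathcal L(x,\lambda)+\frac\sigma2\|Ax-b\|^2$. $\Omega\subset\mathcal H_1\times\mathcal H_2$ is the set of saddle points of $\mathcal L$, equivalently the set of pairs $(x^*,\lambda^* )$ with $\nabla f(x^* )=-A^T\lambda^*$ and $Ax^*=b$; it is assumed nonempty. A global solution of the system is a pair $(x,\lambda)$ with $x\in\mathcal C^2([t_0,+\infty),\mathcal H_1)$, $\lambda\in\mathcal C^2([t_0,+\infty),\mathcal H_2)$, such that $(x,\lambda)$ and $(\dot x,\dot\lambda)$ are locally absolutely continuous and the system holds for almost every $t\ge t_0$. All $\mathcal O(\cdot)$ are as $t\to+\infty$. *)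

theory Defs
  imports "HOL-Analysis.Analysis" "HOL-Library.Landau_Symbols"
begin

definition Lagrangian ::
  "('a::real_inner \<Rightarrow> real) \<Rightarrow> ('a \<Rightarrow> 'b::real_inner) \<Rightarrow> 'b \<Rightarrow> 'a \<Rightarrow> 'b \<Rightarrow> real" where
  "Lagrangian f A b x l = f x + l \<bullet> (A x - b)"

definition aug_Lagrangian ::
  "real \<Rightarrow> ('a::real_inner \<Rightarrow> real) \<Rightarrow> ('a \<Rightarrow> 'b::real_inner) \<Rightarrow> 'b \<Rightarrow> 'a \<Rightarrow> 'b \<Rightarrow> real" where
  "aug_Lagrangian \<sigma> f A b x l = Lagrangian f A b x l + \<sigma> / 2 * (norm (A x - b))\<^sup>2"

definition saddle_points :: "('a \<Rightarrow> 'b \<Rightarrow> real) \<Rightarrow> ('a \<times> 'b) set" where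
  "saddle_points L = {(x, l). (\<forall>l'. L x l' \<le> L x l) \<and> (\<forall>x'. L x l \<le> L x' l)}"

text \<open>Bochner integrability with respect to Lebesgue measure (almost everywhere limit of simple
  functions, with integrable norm). The library's \<open>integrable\<close> requires a second countable
  codomain, which would exclude nonseparable Hilbert spaces.\<close>

definition Bochner_integrable_on :: "(real \<Rightarrow> 'a::real_normed_vector) \<Rightarrow> real set \<Rightarrow> bool"
    (infixr "Bochner'_integrable'_on" 46) where
  "f Bochner_integrable_on S \<longleftrightarrow>
     (\<exists>g :: nat \<Rightarrow> real \<Rightarrow> 'a. (\<forall>i. simple_function (lebesgue_on S) (g i)) \<and>
        (AE t in lebesgue_on S. (\<lambda>i. g i t) \<longlonglongrightarrow> f t)) \<and>
     (\<lambda>t. norm (f t)) absolutely_integrable_on S"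

definition absolutely_continuous_on :: "real set \<Rightarrow> (real \<Rightarrow> 'a::metric_space) \<Rightarrow> bool" where
  "absolutely_continuous_on S u \<longleftrightarrow>
     (\<forall>e>0. \<exists>d>0. \<forall>n (a :: nat \<Rightarrow> real) b.
        (\<forall>i<n. a i \<le> b i \<and> {a i..b i} \<subseteq> S) \<and>
        disjoint_family_on (\<lambda>i. {a i<..<b i}) {..<n} \<and>
        (\<Sum>i<n. b i - a i) < d \<longrightarrow>
        (\<Sum>i<n. dist (u (b i)) (u (a i))) < e)"

definition locally_absolutely_continuous_from ::
  "real \<Rightarrow> (real \<Rightarrow> 'a::metric_space) \<Rightarrow> bool" where
  "locally_absolutely_continuous_from t0 u \<longleftrightarrow> (\<forall>T\<ge>t0. absolutely_continuous_on {t0..T} u)"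

text \<open>\<open>u\<close> is of class \<open>C\<^sup>2\<close> on \<open>[t0, \<infinity>)\<close> with first and second derivatives \<open>u'\<close> and \<open>u''\<close>;
  the derivatives at \<open>t0\<close> are one-sided.\<close>

definition C2_from ::
  "real \<Rightarrow> (real \<Rightarrow> 'a::real_normed_vector) \<Rightarrow> (real \<Rightarrow> 'a) \<Rightarrow> (real \<Rightarrow> 'a) \<Rightarrow> bool" where
  "C2_from t0 u u' u'' \<longleftrightarrow>
     (\<forall>t\<ge>t0. (u has_vector_derivative u' t) (at t within {t0..})) \<and>
     (\<forall>t\<ge>t0. (u' has_vector_derivative u'' t) (at t within {t0..})) \<and>
     continuous_on {t0..} u''"

text \<open>Here \<open>gf\<close> is the gradient of the objective, \<open>x'\<close>, \<open>x''\<close> and \<open>l'\<close>, \<open>l''\<close> are the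
  derivatives of the trajectories \<open>x\<close> and \<open>l\<close>.\<close>

definition global_solution ::
  "real \<Rightarrow> real \<Rightarrow> real \<Rightarrow> real \<Rightarrow> real \<Rightarrow> (real \<Rightarrow> real) \<Rightarrow> (real \<Rightarrow> 'a::real_inner) \<Rightarrow>
   ('a \<Rightarrow> 'a) \<Rightarrow> ('a \<Rightarrow> 'b::real_inner) \<Rightarrow> 'b \<Rightarrow>
   (real \<Rightarrow> 'a) \<Rightarrow> (real \<Rightarrow> 'a) \<Rightarrow> (real \<Rightarrow> 'a) \<Rightarrow>
   (real \<Rightarrow> 'b) \<Rightarrow> (real \<Rightarrow> 'b) \<Rightarrow> (real \<Rightarrow> 'b) \<Rightarrow> bool" where
  "global_solution t0 \<alpha> \<delta> \<sigma> s \<beta> \<epsilon> gf A b x x' x'' l l' l'' \<longleftrightarrow>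
     C2_from t0 x x' x'' \<and> C2_from t0 l l' l'' \<and>
     locally_absolutely_continuous_from t0 (\<lambda>t. (x t, l t)) \<and>
     locally_absolutely_continuous_from t0 (\<lambda>t. (x' t, l' t)) \<and>
     (AE t in lebesgue_on {t0..}.
        x'' t + \<alpha> *\<^sub>R x' t =
          - (\<beta> t *\<^sub>R (gf (x t) + adjoint A (l t + (\<delta> * t powr s) *\<^sub>R l' t)
                     + \<sigma> *\<^sub>R adjoint A (A (x t) - b))) + \<epsilon> t \<and>
        l'' t + \<alpha> *\<^sub>R l' t =
          \<beta> t *\<^sub>R (A (x t + (\<delta> * t powr s) *\<^sub>R x' t) - b))"

end

theory Submission
  imports Defs
begin

text \<open>
  Write \<open>w = (x - x\<^sup>*, \<lambda> - \<lambda>\<^sup>*)\<close>, \<open>\<theta> = \<delta> t\<^sup>s\<close> and let \<open>F\<close> be the gap of the augmented Lagrangian. Testing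
  the system with \<open>w + \<theta> w'\<close> makes the primal-dual coupling terms cancel, so that by convexity
  \<open>E = \<theta> \<beta> F + \<langle>w', w\<rangle> + \<theta>/2 \<parallel>w'\<parallel>\<^sup>2 + \<alpha>/2 \<parallel>w\<parallel>\<^sup>2\<close> satisfies
  \<open>E' \<le> - (\<beta> - (\<theta> \<beta>)') F - \<beta> \<sigma>/2 \<parallel>A x - b\<parallel>\<^sup>2 - (\<alpha> \<theta> - 1 - \<theta>'/2) \<parallel>w'\<parallel>\<^sup>2 + \<langle>\<epsilon>, x - x\<^sup>* + \<theta> x'\<rangle>\<close>.
  For large \<open>t\<close> there is \<open>c > 0\<close> with \<open>1 + \<theta>'/2 \<le> (\<alpha> - c) \<theta>\<close>; this makes the last quadratic term
  dissipative and \<open>E\<close> coercive, and the perturbation is at most a multiple of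
  \<open>t\<^bsup>s/2\<^esup> \<parallel>\<epsilon>\<parallel> (1 + E)\<close>. By Gronwall \<open>E\<close> is bounded and the dissipated terms are integrable.
\<close>

section \<open>Riesz representation and adjoints in Hilbert spaces\<close>

text \<open>The representing vector minimizes \<open>\<parallel>x\<parallel>\<^sup>2 - 2 \<phi> x\<close>; by the parallelogram law every minimizing
  sequence is Cauchy.\<close>

lemma riesz_representation:
  fixes \<phi> :: "'a::{real_inner, complete_space} \<Rightarrow> real"
  assumes "bounded_linear \<phi>"
  obtains z where "\<And>x. \<phi> x = x \<bullet> z"
proof -
  interpret bounded_linear \<phi> by fact
  obtain K where K: "\<And>x. norm (\<phi> x) \<le> norm x * K"
    using bounded by blast
  define J where "J x = (norm x)\<^sup>2 - 2 * \<phi> x" for x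
  have J_ge: "- K\<^sup>2 \<le> J x" for x
  proof -
    have "2 * \<phi> x \<le> 2 * (norm x * K)" using K[of x] by simp
    moreover have "0 \<le> (norm x - K)\<^sup>2" by simp
    ultimately show ?thesis unfolding J_def power2_diff by linarith
  qed
  define m where "m = Inf (range J)"
  have bdd: "bdd_below (range J)" using J_ge by (auto intro!: bdd_belowI)
  have m_le: "m \<le> J x" for x
    unfolding m_def by (rule cInf_lower[OF _ bdd]) auto
  have "\<exists>x. J x < m + 1 / Suc n" for n
    using cInf_lessD[of "range J" "m + 1 / Suc n"] by (auto simp: m_def)
  then obtain X where X: "\<And>n. J (X n) < m + 1 / Suc n" by metis
  have par: "(norm (x - y))\<^sup>2 \<le> 2 * (J x - m) + 2 * (J y - m)" for x y
  proof -
    have "(norm (x - y))\<^sup>2 = 2 * J x + 2 * J y - 4 * J ((1 / 2) *\<^sub>R (x + y))"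
      unfolding J_def scaleR add power2_norm_eq_inner by (simp add: algebra_simps inner_commute)
    moreover have "4 * m \<le> 4 * J ((1 / 2) *\<^sub>R (x + y))"
      by (intro mult_left_mono m_le) simp
    ultimately show ?thesis unfolding right_diff_distrib by argo
  qed
  have "Cauchy X"
  proof (rule metric_CauchyI)
    fix e :: real assume "e > 0"
    then obtain N where N: "1 / Suc N < e\<^sup>2 / 4"
      using reals_Archimedean[of "e\<^sup>2 / 4"] by (auto simp: inverse_eq_divide)
    have "dist (X p) (X q) < e" if "p \<ge> N" "q \<ge> N" for p q
    proof -
      have le: "1 / Suc r \<le> 1 / Suc N" if "r \<ge> N" for r
        using that by (simp add: field_simps)
      have "(norm (X p - X q))\<^sup>2 < e\<^sup>2"
        using par[of "X p" "X q"] X[of p] X[of q] N le[OF that(1)] le[OF that(2)] by argo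
      then show ?thesis
        using \<open>e > 0\<close> by (simp add: dist_norm power_less_imp_less_base)
    qed
    then show "\<exists>M. \<forall>p\<ge>M. \<forall>q\<ge>M. dist (X p) (X q) < e" by blast
  qed
  then obtain z where z: "X \<longlonglongrightarrow> z"
    using Cauchy_convergent convergent_def by blast
  have "(\<lambda>n. J (X n)) \<longlonglongrightarrow> J z"
    unfolding J_def by (intro tendsto_intros z tendsto)
  moreover have "(\<lambda>n. m + 1 / Suc n) \<longlonglongrightarrow> m"
    using tendsto_add[OF tendsto_const LIMSEQ_inverse_real_of_nat, of m]
    by (simp add: inverse_eq_divide)
  ultimately have Jz: "J z \<le> m"
    by (rule LIMSEQ_le) (use X less_imp_le in blast)
  have "\<phi> h = h \<bullet> z" for h
  proof -
    define d where "d = h \<bullet> z - \<phi> h"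
    \<comment> \<open>\<open>2 * d\<close> is minus the reversed slope of \<open>J\<close>, that is,
      the derivative of \<open>J\<close> at \<open>z\<close> in direction \<open>h\<close>. The step
      \<open>r\<close> minimizes the majorant \<open>2 * r * d + r^2 * (norm h ^ 2 + 1)\<close> of
      the increment; the added 1 keeps the denominator positive when \<open>h = 0\<close>.\<close>
    define r where "r = - d / ((norm h)\<^sup>2 + 1)"
    have "0 \<le> J (z + r *\<^sub>R h) - J z" using Jz m_le[of "z + r *\<^sub>R h"] by linarith
    also have "\<dots> = 2 * r * d + r\<^sup>2 * (norm h)\<^sup>2"
      unfolding J_def d_def add scaleR power2_norm_eq_inner
      by (simp add: algebra_simps inner_commute power2_eq_square)
    also have "\<dots> \<le> 2 * r * d + r\<^sup>2 * ((norm h)\<^sup>2 + 1)" by (simp add: mult_left_mono)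
    also have "r\<^sup>2 * ((norm h)\<^sup>2 + 1) = - r * d"
    proof -
      have "r * ((norm h)\<^sup>2 + 1) = - d"
        unfolding r_def using add_nonneg_pos[OF zero_le_power2[of "norm h"] zero_less_one] by simp
      then show ?thesis by (simp add: power2_eq_square mult.assoc)
    qed
    also have "2 * r * d + - r * d = - (d\<^sup>2 / ((norm h)\<^sup>2 + 1))"
      unfolding r_def by (simp add: power2_eq_square)
    finally have "d\<^sup>2 \<le> 0"
      using add_nonneg_pos[OF zero_le_power2[of "norm h"] zero_less_one]
      by (simp add: divide_le_0_iff)
    then show ?thesis by (simp add: d_def)
  qed
  then show ?thesis using that by blast
qed

text \<open>\<open>adjoint\<close> is defined by a choice operator, so its characteristic identity
  holds once some map satisfies it. Representing the functional
  \<open>x \<mapsto> A x \<bullet> y\<close> for each \<open>y\<close> produces one.\<close>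

lemma adjoint_hilbert:
  fixes A :: "'a::{real_inner, complete_space} \<Rightarrow> 'b::real_inner"
  assumes "bounded_linear A"
  shows "A x \<bullet> y = x \<bullet> adjoint A y"
proof -
  have "\<exists>z. \<forall>x. A x \<bullet> y = x \<bullet> z" for y
    by (rule riesz_representation[OF bounded_linear_compose[OF bounded_linear_inner_left assms]]) blast
  then have "\<exists>f'. \<forall>x y. A x \<bullet> y = x \<bullet> f' y" by metis
  then show ?thesis unfolding adjoint_def by (rule someI2_ex) blast
qed

text \<open>A vector is determined by its inner products, which gives linearity. The bound comes
  from testing the adjoint identity with \<open>adjoint A y\<close> itself and cancelling one factor
  of its norm. The continuity of the right-hand side of the system along a trajectory relies on
  this.\<close>

lemma bounded_linear_adjoint_hilbert:
  fixes A :: "'a::{real_inner, complete_space} \<Rightarrow> 'b::real_inner"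
  assumes "bounded_linear A"
  shows "bounded_linear (adjoint A)"
proof -
  note adj = adjoint_hilbert[OF assms, symmetric]
  obtain K where K: "\<And>x. norm (A x) \<le> norm x * K" "K \<ge> 0"
    using bounded_linear.nonneg_bounded[OF assms] by metis
  show ?thesis
  proof (rule bounded_linear_intro)
    show "adjoint A (y + z) = adjoint A y + adjoint A z" for y z
      by (rule vector_eq_ldot[THEN iffD1], intro allI) (simp add: adj inner_add_right)
    show "adjoint A (r *\<^sub>R y) = r *\<^sub>R adjoint A y" for r y
      by (rule vector_eq_ldot[THEN iffD1], intro allI) (simp add: adj)
    show "norm (adjoint A y) \<le> norm y * K" for y
    proof (cases "adjoint A y = 0")
      case False
      have "(norm (adjoint A y))\<^sup>2 = A (adjoint A y) \<bullet> y"
        by (simp add: power2_norm_eq_inner adj)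
      also have "\<dots> \<le> norm (A (adjoint A y)) * norm y" by (rule norm_cauchy_schwarz)
      also have "\<dots> \<le> norm (adjoint A y) * K * norm y" by (simp add: K mult_right_mono)
      finally show ?thesis using False by (simp add: power2_eq_square mult_ac)
    qed (use K in simp)
  qed
qed

section \<open>Convexity and saddle points\<close>

text \<open>Restricting \<open>f\<close> to the line through \<open>z\<close> and \<open>y\<close>
  reduces this to the tangent inequality for a convex function of one real variable, taken at
  parameter 0 and evaluated at 1.\<close>

lemma convex_on_ge_gradient:
  fixes f :: "'a::real_inner \<Rightarrow> real"
  assumes "convex_on UNIV f" and "GDERIV f z :> g"
  shows "f z + g \<bullet> (y - z) \<le> f y"
proof -
  define h where "h r = f (z + r *\<^sub>R (y - z))" for r
  have "convex_on UNIV h"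
  proof (rule convex_onI)
    fix t r q :: real assume "0 < t" "t < 1"
    have "z + ((1 - t) * r + t * q) *\<^sub>R (y - z)
        = (1 - t) *\<^sub>R (z + r *\<^sub>R (y - z)) + t *\<^sub>R (z + q *\<^sub>R (y - z))"
      by (simp add: algebra_simps)
    then show "h ((1 - t) *\<^sub>R r + t *\<^sub>R q) \<le> (1 - t) * h r + t * h q"
      unfolding h_def using convex_onD[OF assms(1), of t] \<open>0 < t\<close> \<open>t < 1\<close> by simp
  qed simp
  moreover have "(h has_real_derivative g \<bullet> (y - z)) (at 0)"
  proof -
    have "(f has_derivative (\<lambda>h. h \<bullet> g)) (at (z + 0 *\<^sub>R (y - z)))"
      using assms(2) by (simp add: gderiv_def)
    then have "((\<lambda>r. f (z + r *\<^sub>R (y - z))) has_derivative (\<lambda>r. (r *\<^sub>R (y - z)) \<bullet> g)) (at 0)"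
      by (rule has_derivative_compose[rotated]) (auto intro!: derivative_eq_intros)
    then show ?thesis
      unfolding h_def has_field_derivative_def
      by (rule has_derivative_eq_rhs) (auto simp: inner_commute)
  qed
  ultimately have "g \<bullet> (y - z) * (1 - 0) \<le> h 1 - h 0"
    by (intro convex_on_imp_above_tangent[of UNIV]) auto
  then show ?thesis by (simp add: h_def)
qed

text \<open>The Lagrangian is affine in the multiplier, so a maximizing multiplier forces the slope
  \<open>A x - b\<close> to vanish; moving the multiplier by that slope shows it.\<close>

lemma saddle_point_feasible:
  fixes A :: "'a::real_inner \<Rightarrow> 'b::real_inner"
  assumes "(x, l) \<in> saddle_points (Lagrangian f A b)"
  shows "A x = b"
proof -
  have "l' \<bullet> (A x - b) \<le> l \<bullet> (A x - b)" for l'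
    using assms by (auto simp: saddle_points_def Lagrangian_def)
  from this[of "l + (A x - b)"] have "(A x - b) \<bullet> (A x - b) \<le> 0"
    by (simp add: inner_add_left)
  then have "(A x - b) \<bullet> (A x - b) = 0"
    by (rule antisym) simp
  then show ?thesis by simp
qed

text \<open>The gradient of the penalty, paired with \<open>x - z\<close>, gives twice the penalty
  because the penalty is quadratic in \<open>x - z\<close>. One copy belongs to the gap; the other
  is the extra term on the left, which later dissipates infeasibility.\<close>

lemma aug_Lagrangian_ge_gradient:
  fixes f :: "'a::{real_inner, complete_space} \<Rightarrow> real"
    and A :: "'a \<Rightarrow> 'b::{real_inner, complete_space}"
  assumes A: "bounded_linear A" and f: "convex_on UNIV f" "GDERIV f x :> g"
    and z: "A z = b"
  shows "aug_Lagrangian \<sigma> f A b x l - aug_Lagrangian \<sigma> f A b z l + \<sigma> / 2 * (norm (A x - b))\<^sup>2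
    \<le> (g + adjoint A l + \<sigma> *\<^sub>R adjoint A (A x - b)) \<bullet> (x - z)"
proof -
  have Axz: "A (x - z) = A x - b"
    by (simp add: linear_diff[OF bounded_linear.linear[OF A]] z)
  have "f x - f z \<le> g \<bullet> (x - z)"
    using convex_on_ge_gradient[OF f, of z] by (simp add: inner_diff_right)
  moreover have "adjoint A y \<bullet> (x - z) = y \<bullet> (A x - b)" for y
    by (metis Axz adjoint_hilbert[OF A] inner_commute)
  ultimately show ?thesis
    by (simp add: aug_Lagrangian_def Lagrangian_def z inner_add_left power2_norm_eq_inner)
qed

section \<open>Half-line integrability, Gronwall bounds and coercivity\<close>

text \<open>Monotone convergence for the truncations of \<open>h\<close> to
  \<open>{a..a + n}\<close>, whose integrals stay in \<open>{0..C}\<close>.\<close>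

lemma nonneg_continuous_integrable_halfline:
  fixes h :: "real \<Rightarrow> real"
  assumes cont: "continuous_on {a..} h" and nonneg: "\<And>t. t \<ge> a \<Longrightarrow> 0 \<le> h t"
    and bound: "\<And>t. t \<ge> a \<Longrightarrow> integral {a..t} h \<le> C"
  shows "h integrable_on {a..}"
proof -
  have int: "h integrable_on {a..t}" for t
    by (intro integrable_continuous_interval continuous_on_subset[OF cont]) auto
  define g where "g n t = (if t \<in> {a..a + real n} then h t else 0)" for n t
  have ig: "integral {a..} (g n) = integral {a..a + n} h" for n
    unfolding g_def using integral_restrict_Int[of "{a..}" "{a..a + real n}" h]
    by (simp add: Int_absorb1)
  show ?thesis
  proof (rule monotone_convergence_increasing[THEN conjunct1])
    show "g n integrable_on {a..}" for n
      unfolding g_def using int[of "a + n"]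
      by (subst integrable_restrict_Int) (simp add: Int_absorb1 Int_absorb2)
    show "g n t \<le> g (Suc n) t" if "t \<in> {a..}" for n t
      using that nonneg by (auto simp: g_def)
    show "(\<lambda>n. g n t) \<longlonglongrightarrow> h t" if "t \<in> {a..}" for t
    proof (rule tendsto_eventually)
      show "\<forall>\<^sub>F n in sequentially. g n t = h t"
        using eventually_ge_at_top[of "nat \<lceil>t - a\<rceil>"]
        by eventually_elim (use that in \<open>auto simp: g_def nat_le_iff ceiling_le_iff\<close>)
    qed
    have "0 \<le> integral {a..a + n} h" for n :: nat
      by (rule integral_nonneg[OF int]) (use nonneg in auto)
    then show "bounded (range (\<lambda>n. integral {a..} (g n)))"
      unfolding ig bounded_iff using bound by (intro exI[of _ C]) auto
  qed
qed

text \<open>Gronwall is used in two stages. The integrating factor \<open>exp (- K t)\<close> first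
  bounds \<open>1 + E\<close> by a constant. With that constant in place of \<open>1 + E\<close>,
  the inequality becomes linear and can be integrated with \<open>D\<close> kept on the
  left.\<close>

lemma energy_bound:
  fixes E E' k D :: "real \<Rightarrow> real"
  assumes E': "\<And>t. t \<ge> a \<Longrightarrow> (E has_real_derivative E' t) (at t)"
    and E: "\<And>t. t \<ge> a \<Longrightarrow> 0 \<le> E t"
    and k: "continuous_on {a..} k" "\<And>t. t \<ge> a \<Longrightarrow> 0 \<le> k t" "k integrable_on {a..}"
    and D: "continuous_on {a..} D" "\<And>t. t \<ge> a \<Longrightarrow> 0 \<le> D t"
    and le: "\<And>t. t \<ge> a \<Longrightarrow> E' t \<le> k t * (1 + E t) - D t"
  obtains M where "\<And>t. t \<ge> a \<Longrightarrow> E t \<le> M" "\<And>t. t \<ge> a \<Longrightarrow> integral {a..t} D \<le> M"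
proof -
  \<comment> \<open>For \<open>t < a\<close> the integral is 0, so a two-sided derivative may fail
    at \<open>a\<close>. The monotonicity arguments below therefore use derivatives in the open
    interval and continuity on the closed one.\<close>
  have deriv: "((\<lambda>t. integral {a..t} h) has_real_derivative h t) (at t)"
    if "continuous_on {a..} h" "a < t" for h :: "real \<Rightarrow> real" and t
  proof -
    have "((\<lambda>t. integral {a..t} h) has_real_derivative h t) (at t within {a..t + 1})"
      using that by (intro integral_has_real_derivative continuous_on_subset[OF that(1)]) auto
    then show ?thesis
      using at_within_interior[of t "{a..t + 1}"] that by (simp add: interior_atLeastAtMost_real)
  qed
  have cont: "continuous_on {a..t} (\<lambda>t. integral {a..t} h)"
    if "continuous_on {a..} h" for h :: "real \<Rightarrow> real" and t
    by (intro indefinite_integral_continuous_1 integrable_continuous_interval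
        continuous_on_subset[OF that]) auto
  have contE: "continuous_on {a..t} E" for t
    by (rule DERIV_atLeastAtMost_imp_continuous_on) (use E' in blast)
  define K where "K t = integral {a..t} k" for t
  define Q where "Q t = integral {a..t} D" for t
  define I where "I = integral {a..} k"
  have int_k: "k integrable_on {a..t}" for t
    by (intro integrable_continuous_interval continuous_on_subset[OF k(1)]) auto
  have K_le: "K t \<le> I" for t
    unfolding K_def I_def by (rule integral_subset_le[OF _ int_k k(3)]) (use k(2) in auto)
  have K_ge: "0 \<le> K t" for t
    unfolding K_def by (rule integral_nonneg[OF int_k]) (use k(2) in auto)
  have gronwall: "(1 + E t) * exp (- K t) \<le> (1 + E a) * exp (- K a)" if "t \<ge> a" for t
  proof (cases "t = a")
    case False
    show ?thesis
    proof (rule DERIV_nonpos_imp_decreasing_open[of a t "\<lambda>t. (1 + E t) * exp (- K t)"])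
      fix r assume r: "a < r" "r < t"
      have "((\<lambda>t. (1 + E t) * exp (- K t)) has_real_derivative
          (E' r - k r * (1 + E r)) * exp (- K r)) (at r)"
        unfolding K_def using r deriv[OF k(1), of r] E'[of r]
        by (auto intro!: derivative_eq_intros simp: algebra_simps)
      moreover have "(E' r - k r * (1 + E r)) * exp (- K r) \<le> 0"
        using le[of r] D(2)[of r] r by (intro mult_nonpos_nonneg) auto
      ultimately show "\<exists>y. ((\<lambda>t. (1 + E t) * exp (- K t)) has_real_derivative y) (at r) \<and> y \<le> 0"
        by blast
    qed (use that in \<open>auto simp: K_def intro!: continuous_intros contE cont k\<close>)
  qed simp
  have E_le: "1 + E t \<le> (1 + E a) * exp I" if "t \<ge> a" for t
  proof -
    have "1 + E t = (1 + E t) * exp (- K t) * exp (K t)" by (simp add: exp_minus)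
    also have "\<dots> \<le> ((1 + E a) * exp (- K a)) * exp (K t)"
      using gronwall[OF that] by (rule mult_right_mono) simp
    also have "\<dots> \<le> (1 + E a) * exp I"
      using K_le[of t] E[of a] by (simp add: K_def)
    finally show ?thesis .
  qed
  define M where "M = (1 + E a) * exp I"
  have M0: "0 \<le> M" unfolding M_def using E[of a] by simp
  \<comment> \<open>Since \<open>1 + E\<close> is at most \<open>M\<close>, the growth term is at
    most \<open>M * k\<close>, which is the derivative of \<open>M * K\<close>.\<close>
  have "E t + Q t - M * K t \<le> E a + Q a - M * K a" if "t \<ge> a" for t
  proof (cases "t = a")
    case False
    show ?thesis
    proof (rule DERIV_nonpos_imp_decreasing_open[of a t "\<lambda>t. E t + Q t - M * K t"])
      fix r assume r: "a < r" "r < t"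
      have "((\<lambda>t. E t + Q t - M * K t) has_real_derivative E' r + D r - M * k r) (at r)"
        unfolding K_def Q_def using r deriv[OF k(1), of r] deriv[OF D(1), of r] E'[of r]
        by (auto intro!: derivative_eq_intros)
      moreover have "k r * (1 + E r) \<le> k r * M"
        using E_le[of r] k(2)[of r] r by (auto simp: M_def intro!: mult_left_mono)
      then have "E' r + D r - M * k r \<le> 0"
        using le[of r] r by (simp add: mult.commute)
      ultimately show "\<exists>y. ((\<lambda>t. E t + Q t - M * K t) has_real_derivative y) (at r) \<and> y \<le> 0"
        by blast
    qed (use that in \<open>auto simp: K_def Q_def intro!: continuous_intros contE cont k D\<close>)
  qed simp
  then have "E t + Q t - M * K t \<le> M" if "t \<ge> a" for t
    using that E_le[of a] by (force simp: K_def Q_def M_def)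
  then have "Q t \<le> M + M * I" if "t \<ge> a" for t
    using that E[of t] mult_left_mono[OF K_le[of t] M0] by force
  moreover have "E t \<le> M + M * I" if "t \<ge> a" for t
    using E_le[OF that] K_ge[of a] K_le[of a] M0 mult_nonneg_nonneg[OF M0, of I]
    unfolding M_def[symmetric] by linarith
  ultimately show ?thesis using that unfolding Q_def by blast
qed

text \<open>The form is split as a square completed with weight \<open>r = \<alpha> - c / 2\<close>,
  midway between \<open>\<alpha> - c\<close> and \<open>\<alpha>\<close>, plus a remainder. Because
  \<open>r^2\<close> is at least \<open>\<alpha> * (\<alpha> - c)\<close>, the completed part is
  nonnegative, and the remaining \<open>c / 2\<close> of \<open>\<alpha>\<close> yields both
  coefficients on the left.\<close>

lemma quadratic_coercive:
  fixes \<alpha> c \<theta> p q :: real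
  assumes "0 < c" "c < \<alpha>" "1 \<le> (\<alpha> - c) * \<theta>"
  shows "c / 4 * p\<^sup>2 + c / (4 * \<alpha>) * (\<theta> * q\<^sup>2) \<le> \<theta> / 2 * q\<^sup>2 - p * q + \<alpha> / 2 * p\<^sup>2"
proof -
  have pos: "\<alpha> > 0" "\<theta> > 0"
    using assms by (auto simp: zero_less_mult_iff dest: less_le_trans[OF zero_less_one])
  define r where "r = \<alpha> - c / 2"
  have "\<alpha> \<le> \<alpha> * ((\<alpha> - c) * \<theta>)" using assms pos by simp
  also have "\<dots> \<le> r\<^sup>2 * \<theta>"
    using pos by (simp add: r_def power2_eq_square algebra_simps)
  finally have r2: "\<alpha> \<le> r\<^sup>2 * \<theta>" .
  have r0: "r > 0" using assms by (simp add: r_def)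
  have "0 \<le> (r * p - q)\<^sup>2 / (2 * r) + (r\<^sup>2 * \<theta> - \<alpha>) * q\<^sup>2 / (2 * \<alpha> * r)"
    using r2 r0 pos by simp
  also have "\<dots> = r / 2 * p\<^sup>2 - p * q + r * \<theta> / (2 * \<alpha>) * q\<^sup>2"
    using r0 pos by (simp add: field_simps power2_eq_square)
  finally show ?thesis
    using pos by (simp add: r_def field_simps)
qed

text \<open>The energy estimate controls \<open>h\<close> only from some time \<open>c\<close> on;
  the compact piece \<open>{a..c}\<close> is covered by continuity.\<close>

lemma integrable_halfline_dominated_tail:
  fixes h D :: "real \<Rightarrow> real"
  assumes h: "continuous_on {a..} h" "\<And>t. t \<ge> a \<Longrightarrow> 0 \<le> h t"
    and D: "continuous_on {c..} D" "\<And>t. t \<ge> c \<Longrightarrow> integral {c..t} D \<le> M"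
    and "a \<le> c" "0 < C" and le: "\<And>t. t \<ge> c \<Longrightarrow> C * h t \<le> D t"
  shows "h absolutely_integrable_on {a..}"
proof -
  have int_h: "h integrable_on {p..q}" if "a \<le> p" for p q
    using that by (intro integrable_continuous_interval continuous_on_subset[OF h(1)]) auto
  have tail: "integral {c..t} h \<le> M / C" if "t \<ge> c" for t
  proof -
    have "C * integral {c..t} h = integral {c..t} (\<lambda>t. C * h t)" by simp
    also have "\<dots> \<le> integral {c..t} D"
    proof (rule integral_le)
      show "(\<lambda>t. C * h t) integrable_on {c..t}"
        using integrable_on_cmult_left[OF int_h[OF \<open>a \<le> c\<close>]] by simp
      show "D integrable_on {c..t}"
        by (intro integrable_continuous_interval continuous_on_subset[OF D(1)]) auto
    qed (use le in auto)
    also have "\<dots> \<le> M" by (rule D(2)[OF that])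
    finally show ?thesis using \<open>0 < C\<close> by (simp add: field_simps)
  qed
  have bound: "integral {a..t} h \<le> integral {a..c} h + M / C" if "t \<ge> a" for t
  proof -
    \<comment> \<open>Enlarging the interval to \<open>max c t\<close> treats times before and after
      \<open>c\<close> together.\<close>
    have "integral {a..t} h \<le> integral {a..max c t} h"
      by (rule integral_subset_le[OF _ int_h int_h]) (use h(2) in auto)
    also have "\<dots> = integral {a..c} h + integral {c..max c t} h"
      using \<open>a \<le> c\<close> by (intro Henstock_Kurzweil_Integration.integral_combine[symmetric] int_h) auto
    finally show ?thesis using tail[of "max c t"] by simp
  qed
  have "h integrable_on {a..}"
    by (rule nonneg_continuous_integrable_halfline[OF h bound])
  then show ?thesis
    using h(2) by (intro nonnegative_absolutely_integrable_1) auto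
qed

text \<open>The zero set is closed and has full measure, hence contains the open half-line
  \<open>{a<..}\<close>.\<close>

lemma continuous_AE_zero_halfline:
  fixes h :: "real \<Rightarrow> 'a::real_normed_vector"
  assumes "continuous_on {a..} h" and "AE t in lebesgue_on {a..}. h t = 0" and "a < t"
  shows "h t = 0"
proof -
  have closed: "closed {t \<in> {a..}. h t = 0}"
    by (intro continuous_closed_preimage_constant assms) auto
  have ae: "AE r \<in> {a<..} in lebesgue. r \<in> {t \<in> {a..}. h t = 0}"
    using assms(2) by (auto simp: AE_restrict_space_iff elim!: eventually_mono)
  have "t \<in> {t \<in> {a..}. h t = 0}"
    by (rule mem_closed_if_AE_lebesgue_open[OF open_greaterThan closed ae]) (use \<open>a < t\<close> in simp)
  then show ?thesis by simp
qed

lemma absolutely_integrable_cong_AE: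
  fixes g h :: "real \<Rightarrow> real"
  assumes "g absolutely_integrable_on {a..}" and "AE t in lebesgue_on {a..}. h t = g t"
  shows "h absolutely_integrable_on {a..}"
proof -
  have "AE t in lebesgue. t \<in> {a..} \<longrightarrow> h t = g t"
    using assms(2) by (simp add: AE_restrict_space_iff)
  then obtain N where "N \<in> null_sets lebesgue" "{t. \<not> (t \<in> {a..} \<longrightarrow> h t = g t)} \<subseteq> N"
    by (auto simp: eventually_ae_filter)
  then show ?thesis
    by (intro absolutely_integrable_spike[OF assms(1), of N]) (auto simp: negligible_iff_null_sets)
qed

text \<open>For \<open>s = 0\<close> the claim reads
  \<open>1 \<le> (\<alpha> - c) * \<delta>\<close>; \<open>c = \<alpha> - 1 / \<delta>\<close> makes
  it an equality and is positive since \<open>\<alpha> * \<delta> > 1\<close>. For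
  \<open>s > 0\<close> half of the damping suffices, as \<open>t powr s\<close> grows while
  \<open>s * t powr (s - 1)\<close> stays at most 1 for \<open>t \<ge> 1\<close>.\<close>

lemma overdamped_eventually:
  fixes \<alpha> \<delta> s t0 :: real
  assumes "\<alpha> > 0" "\<delta> > 0" "s \<in> {0..1}" "s = 0 \<Longrightarrow> \<alpha> * \<delta> > 1"
  obtains c t1 where "0 < c" "c < \<alpha>" "1 \<le> t1" "t0 < t1"
    "\<And>t. t \<ge> t1 \<Longrightarrow> 1 + \<delta> * (s * t powr (s - 1)) / 2 \<le> (\<alpha> - c) * (\<delta> * t powr s)"
proof (cases "s = 0")
  case True
  show ?thesis
  proof
    show "0 < \<alpha> - 1 / \<delta>" "\<alpha> - 1 / \<delta> < \<alpha>"
      using assms True by (simp_all add: field_simps)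
    show "1 \<le> max 1 (t0 + 1)" "t0 < max 1 (t0 + 1)" by auto
    show "1 + \<delta> * (s * t powr (s - 1)) / 2 \<le> (\<alpha> - (\<alpha> - 1 / \<delta>)) * (\<delta> * t powr s)"
      if "t \<ge> max 1 (t0 + 1)" for t
      using assms True that by simp
  qed
next
  case False
  then have "s > 0" using assms by simp
  define C where "C = (1 + \<delta>) * 2 / (\<alpha> * \<delta>)"
  have "C > 0" using assms by (simp add: C_def)
  \<comment> \<open>\<open>T\<close> is the time at which \<open>t powr s\<close> reaches
    \<open>C\<close>, and \<open>C\<close> solves
    \<open>\<alpha> / 2 * \<delta> * C = 1 + \<delta>\<close>.\<close>
  define T where "T = C powr (1 / s)"
  have T: "C \<le> t powr s" if "t \<ge> T" for t
  proof -
    have "C = T powr s" using \<open>s > 0\<close> \<open>C > 0\<close> by (simp add: T_def powr_powr)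
    also have "\<dots> \<le> t powr s" using \<open>s > 0\<close> that by (intro powr_mono2) (auto simp: T_def)
    finally show ?thesis .
  qed
  show ?thesis
  proof
    show "0 < \<alpha> / 2" "\<alpha> / 2 < \<alpha>" using assms by auto
    show "1 \<le> max T (max 1 (t0 + 1))" "t0 < max T (max 1 (t0 + 1))" by auto
    show "1 + \<delta> * (s * t powr (s - 1)) / 2 \<le> (\<alpha> - \<alpha> / 2) * (\<delta> * t powr s)"
      if "t \<ge> max T (max 1 (t0 + 1))" for t
    proof -
      have t: "1 \<le> t" "T \<le> t" using that by auto
      have "t powr (s - 1) \<le> t powr 0" using t assms by (intro powr_mono) auto
      then have "s * t powr (s - 1) \<le> 1 * 1" using t assms by (intro mult_mono) auto
      then have "\<delta> * (s * t powr (s - 1)) \<le> \<delta>" using assms by simp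
      moreover have "1 + \<delta> \<le> (\<alpha> - \<alpha> / 2) * (\<delta> * t powr s)"
        using T[OF t(2)] assms by (simp add: C_def field_simps)
      ultimately show ?thesis using assms by linarith
    qed
  qed
qed

section \<open>Differentiating the energy\<close>

lemma has_real_derivative_inner:
  fixes p q :: "real \<Rightarrow> 'c::real_inner"
  assumes "(p has_vector_derivative p') (at t)" "(q has_vector_derivative q') (at t)"
  shows "((\<lambda>t. p t \<bullet> q t) has_real_derivative p t \<bullet> q' + p' \<bullet> q t) (at t)"
  using assms unfolding has_vector_derivative_def has_field_derivative_def
  by (auto intro!: derivative_eq_intros simp: algebra_simps)

text \<open>The coefficient \<open>\<alpha> / 2\<close> supplies the cross term
  \<open>\<alpha> * (w' \<bullet> w)\<close> that completes \<open>w'' + \<alpha> w'\<close> paired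
  with \<open>w + \<theta> w'\<close>, so the second-order equation can be substituted as a whole.
  What is left over is a multiple of the squared velocity.\<close>

lemma lyapunov_has_real_derivative:
  fixes w w' :: "real \<Rightarrow> 'c::real_inner"
  assumes w: "(w has_vector_derivative w' t) (at t)" "(w' has_vector_derivative w'') (at t)"
    and \<theta>: "(\<theta> has_real_derivative \<theta>') (at t)" and \<phi>: "(\<phi> has_real_derivative \<phi>') (at t)"
  shows "((\<lambda>t. \<theta> t * \<phi> t + w' t \<bullet> w t + \<theta> t / 2 * (norm (w' t))\<^sup>2 + \<alpha> / 2 * (norm (w t))\<^sup>2)
    has_real_derivative \<theta>' * \<phi> t + \<theta> t * \<phi>' + (w'' + \<alpha> *\<^sub>R w' t) \<bullet> (w t + \<theta> t *\<^sub>R w' t)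
      + (1 + \<theta>' / 2 - \<alpha> * \<theta> t) * (norm (w' t))\<^sup>2) (at t)"
  unfolding power2_norm_eq_inner
  by (rule DERIV_cong[OF DERIV_add[OF DERIV_add[OF DERIV_add[OF DERIV_mult[OF \<theta> \<phi>]
          has_real_derivative_inner[OF w(2) w(1)]]
          DERIV_mult[OF DERIV_cdivide[OF \<theta>] has_real_derivative_inner[OF w(2) w(2)]]]
          DERIV_cmult[OF has_real_derivative_inner[OF w(1) w(1)]]]])
    (simp add: inner_add_left inner_add_right inner_commute[of "w' t" w'']
      inner_commute[of "w' t" "w t"] algebra_simps)

lemma aug_Lagrangian_has_real_derivative:
  fixes f :: "'a::{real_inner, complete_space} \<Rightarrow> real"
    and A :: "'a \<Rightarrow> 'b::{real_inner, complete_space}"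
  assumes A: "bounded_linear A" and f: "GDERIV f (x t) :> g"
    and x: "(x has_vector_derivative x') (at t)"
  shows "((\<lambda>t. aug_Lagrangian \<sigma> f A b (x t) l) has_real_derivative
    (g + adjoint A l + \<sigma> *\<^sub>R adjoint A (A (x t) - b)) \<bullet> x') (at t)"
proof -
  have dx: "(x has_derivative (\<lambda>r. r *\<^sub>R x')) (at t)"
    using x by (simp add: has_vector_derivative_def)
  have "(f has_derivative (\<lambda>h. h \<bullet> g)) (at (x t))" using f by (simp add: gderiv_def)
  from has_derivative_compose[OF dx this]
  have df: "((\<lambda>t. f (x t)) has_real_derivative g \<bullet> x') (at t)"
    unfolding has_field_derivative_def
    by (rule has_derivative_eq_rhs) (simp add: fun_eq_iff inner_commute)
  have dA: "((\<lambda>t. A (x t) - b) has_vector_derivative A x') (at t)"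
    using has_vector_derivative_diff[OF bounded_linear.has_vector_derivative[OF A x]
        has_vector_derivative_const] by simp
  have adj: "adjoint A y \<bullet> x' = y \<bullet> A x'" for y
    by (metis adjoint_hilbert[OF A] inner_commute)
  show ?thesis
    unfolding aug_Lagrangian_def Lagrangian_def power2_norm_eq_inner
    by (rule DERIV_cong[OF DERIV_add[OF DERIV_add[OF df
            has_real_derivative_inner[OF has_vector_derivative_const dA]]
            DERIV_cmult[OF has_real_derivative_inner[OF dA dA]]]])
      (simp add: inner_add_left adj inner_commute[of "A x'"])
qed

text \<open>Besides the coupling terms, \<open>\<theta> * \<beta> * (G \<bullet> x')\<close>
  cancels: it arises once from differentiating \<open>F\<close> and once, with opposite sign, from
  the tested equation. Only \<open>G \<bullet> (x - xs)\<close> remains, to which the gradient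
  inequality applies.\<close>

lemma energy_dissipation:
  fixes f :: "'a::{real_inner, complete_space} \<Rightarrow> real"
    and A :: "'a \<Rightarrow> 'b::{real_inner, complete_space}"
    and x x' :: "real \<Rightarrow> 'a" and l l' :: "real \<Rightarrow> 'b" and xs :: 'a and ls :: 'b
  assumes A: "bounded_linear A" and f: "convex_on UNIV f" "GDERIV f (x t) :> g"
    and feas: "A xs = b"
    and x: "(x has_vector_derivative x' t) (at t)" "(x' has_vector_derivative x'') (at t)"
    and l: "(l has_vector_derivative l' t) (at t)" "(l' has_vector_derivative l'') (at t)"
    and \<theta>: "(\<theta> has_real_derivative \<theta>') (at t)"
    and \<beta>: "(\<beta> has_real_derivative \<beta>') (at t)" "0 \<le> \<beta> t"
    and eq_x: "x'' + \<alpha> *\<^sub>R x' t = - (\<beta> t *\<^sub>R (g + adjoint A (l t + \<theta> t *\<^sub>R l' t)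
                     + \<sigma> *\<^sub>R adjoint A (A (x t) - b))) + e"
    and eq_l: "l'' + \<alpha> *\<^sub>R l' t = \<beta> t *\<^sub>R (A (x t + \<theta> t *\<^sub>R x' t) - b)"
  defines "F \<equiv> \<lambda>t. aug_Lagrangian \<sigma> f A b (x t) ls - aug_Lagrangian \<sigma> f A b xs ls"
    and "w \<equiv> \<lambda>t. (x t - xs, l t - ls)" and "w' \<equiv> \<lambda>t. (x' t, l' t)"
  shows "\<exists>E'. ((\<lambda>t. \<theta> t * (\<beta> t * F t) + w' t \<bullet> w t + \<theta> t / 2 * (norm (w' t))\<^sup>2
        + \<alpha> / 2 * (norm (w t))\<^sup>2) has_real_derivative E') (at t) \<and>
    E' \<le> e \<bullet> (x t - xs + \<theta> t *\<^sub>R x' t) - (\<beta> t - (\<theta>' * \<beta> t + \<theta> t * \<beta>')) * F t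
      - \<sigma> / 2 * (\<beta> t * (norm (A (x t) - b))\<^sup>2) - (\<alpha> * \<theta> t - (1 + \<theta>' / 2)) * (norm (w' t))\<^sup>2"
proof -
  define G where "G = g + adjoint A ls + \<sigma> *\<^sub>R adjoint A (A (x t) - b)"
  have dF: "(F has_real_derivative G \<bullet> x' t) (at t)"
    unfolding F_def G_def
    using DERIV_diff[OF aug_Lagrangian_has_real_derivative[OF A f(2) x(1)] DERIV_const] by simp
  have "((\<lambda>t. \<beta> t * F t) has_real_derivative \<beta>' * F t + \<beta> t * (G \<bullet> x' t)) (at t)"
    by (rule derivative_eq_intros \<beta> dF refl)+ simp
  moreover have "(w has_vector_derivative w' t) (at t)"
    unfolding w_def w'_def using x l
    by (auto intro!: has_vector_derivative_Pair derivative_eq_intros)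
  moreover have "(w' has_vector_derivative (x'', l'')) (at t)"
    unfolding w'_def using x l by (auto intro!: has_vector_derivative_Pair)
  moreover note \<theta>
  ultimately have dE: "((\<lambda>t. \<theta> t * (\<beta> t * F t) + w' t \<bullet> w t + \<theta> t / 2 * (norm (w' t))\<^sup>2
        + \<alpha> / 2 * (norm (w t))\<^sup>2) has_real_derivative
      \<theta>' * (\<beta> t * F t) + \<theta> t * (\<beta>' * F t + \<beta> t * (G \<bullet> x' t))
      + ((x'', l'') + \<alpha> *\<^sub>R w' t) \<bullet> (w t + \<theta> t *\<^sub>R w' t)
      + (1 + \<theta>' / 2 - \<alpha> * \<theta> t) * (norm (w' t))\<^sup>2) (at t)"
    by (intro lyapunov_has_real_derivative)
  \<comment> \<open>Feasibility of \<open>xs\<close> turns the residual in the second equation into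
    \<open>A p\<close>, and \<open>G\<close> absorbs \<open>adjoint A ls\<close> in the first. The
    coupling terms are then \<open>A p \<bullet> q\<close> with opposite signs.\<close>
  define p where "p = x t - xs + \<theta> t *\<^sub>R x' t"
  define q where "q = l t - ls + \<theta> t *\<^sub>R l' t"
  have Alin: "linear A" and adjlin: "linear (adjoint A)"
    using A bounded_linear_adjoint_hilbert[OF A] bounded_linear.linear by blast+
  have adj: "adjoint A y \<bullet> z = A z \<bullet> y" for y z
    by (metis adjoint_hilbert[OF A] inner_commute)
  have "x t + \<theta> t *\<^sub>R x' t = p + xs" by (simp add: p_def)
  then have eq_l': "l'' + \<alpha> *\<^sub>R l' t = \<beta> t *\<^sub>R A p"
    unfolding eq_l by (simp add: linear_add[OF Alin] feas)
  have "l t + \<theta> t *\<^sub>R l' t = q + ls" by (simp add: q_def)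
  then have eq_x': "x'' + \<alpha> *\<^sub>R x' t = e - \<beta> t *\<^sub>R (G + adjoint A q)"
    unfolding eq_x G_def by (simp add: linear_add[OF adjlin] algebra_simps)
  have "((x'', l'') + \<alpha> *\<^sub>R w' t) \<bullet> (w t + \<theta> t *\<^sub>R w' t)
      = (x'' + \<alpha> *\<^sub>R x' t) \<bullet> p + (l'' + \<alpha> *\<^sub>R l' t) \<bullet> q"
    by (simp add: w_def w'_def p_def q_def)
  also have "\<dots> = e \<bullet> p - \<beta> t * (G \<bullet> p)"
    unfolding eq_x' eq_l' by (simp add: inner_diff_left inner_add_left adj algebra_simps)
  also have "G \<bullet> p = G \<bullet> (x t - xs) + \<theta> t * (G \<bullet> x' t)"
    by (simp add: p_def inner_add_right)
  finally have pair: "((x'', l'') + \<alpha> *\<^sub>R w' t) \<bullet> (w t + \<theta> t *\<^sub>R w' t)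
      = e \<bullet> p - \<beta> t * (G \<bullet> (x t - xs) + \<theta> t * (G \<bullet> x' t))" .
  have "F t + \<sigma> / 2 * (norm (A (x t) - b))\<^sup>2 \<le> G \<bullet> (x t - xs)"
    unfolding F_def G_def by (rule aug_Lagrangian_ge_gradient[OF A f feas])
  then have "\<beta> t * (F t + \<sigma> / 2 * (norm (A (x t) - b))\<^sup>2) \<le> \<beta> t * (G \<bullet> (x t - xs))"
    using \<beta>(2) by (rule mult_left_mono)
  then show ?thesis
    unfolding p_def[symmetric]
    by - (rule exI, rule conjI, rule dE[unfolded pair], simp add: algebra_simps)
qed

section \<open>Energy estimates along a trajectory\<close>

theorem theorem2p1:
  fixes f :: "'a::{real_inner, complete_space} \<Rightarrow> real"
    and gf :: "'a \<Rightarrow> 'a"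
    and A :: "'a \<Rightarrow> 'b::{real_inner, complete_space}"
    and b :: 'b
    and t0 \<alpha> \<delta> \<sigma> s :: real
    and \<beta> \<beta>' :: "real \<Rightarrow> real"
    and \<epsilon> x x' x'' :: "real \<Rightarrow> 'a"
    and l l' l'' :: "real \<Rightarrow> 'b"
    and xs :: 'a and ls :: 'b
  assumes "bounded_linear A"
    and "convex_on UNIV f"
    and "\<And>z. GDERIV f z :> gf z" and "continuous_on UNIV gf"
    and "t0 > 0" and "\<alpha> > 0" and "\<delta> > 0" and "\<sigma> > 0" and "s \<in> {0..1}"
    and "s = 0 \<Longrightarrow> \<alpha> * \<delta> > 1" and "s = 1 \<Longrightarrow> \<delta> \<le> 1"
    and "\<And>t. t \<ge> t0 \<Longrightarrow> \<beta> t > 0"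
    and "\<And>t. t \<ge> t0 \<Longrightarrow> (\<beta> has_real_derivative \<beta>' t) (at t within {t0..})"
    and "continuous_on {t0..} \<beta>'"
    and "\<And>t. t \<ge> t0 \<Longrightarrow> t powr s * \<beta>' t \<le> (1 / \<delta> - s * t powr (s - 1)) * \<beta> t"
    and "\<epsilon> Bochner_integrable_on {t0..}"
    and "(\<lambda>t. t powr (s / 2) * norm (\<epsilon> t)) absolutely_integrable_on {t0..}"
    and "global_solution t0 \<alpha> \<delta> \<sigma> s \<beta> \<epsilon> gf A b x x' x'' l l' l''"
    and "(xs, ls) \<in> saddle_points (Lagrangian f A b)"
  shows "bounded ((\<lambda>t. (x t, l t)) ` {t0..}) \<and>
    (\<lambda>t. ((1 / \<delta> - s * t powr (s - 1)) * \<beta> t - t powr s * \<beta>' t) *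
          (aug_Lagrangian \<sigma> f A b (x t) ls - aug_Lagrangian \<sigma> f A b xs ls))
      absolutely_integrable_on {t0..} \<and>
    (\<lambda>t. t powr s * ((norm (x' t))\<^sup>2 + (norm (l' t))\<^sup>2)) absolutely_integrable_on {t0..} \<and>
    (\<lambda>t. \<beta> t * (norm (A (x t) - b))\<^sup>2) absolutely_integrable_on {t0..} \<and>
    (\<lambda>t. norm (x' t) + norm (l' t)) \<in> O[at_top](\<lambda>t. 1 / t powr (s / 2)) \<and>
    (filterlim (\<lambda>t. t powr s * \<beta> t) at_top at_top \<longrightarrow>
      (\<lambda>t. Lagrangian f A b (x t) ls - Lagrangian f A b xs ls)
        \<in> O[at_top](\<lambda>t. 1 / (t powr s * \<beta> t)) \<and>
      (\<lambda>t. norm (A (x t) - b)) \<in> O[at_top](\<lambda>t. 1 / (t powr (s / 2) * sqrt (\<beta> t))))"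
proof -
  note A = assms(1) and f = assms(2) and gf = assms(3) and cont_gf = assms(4)
    and t0 = assms(5) and \<alpha> = assms(6) and \<delta> = assms(7) and \<sigma> = assms(8)
    and \<beta> = assms(12) and d\<beta> = assms(13) and cont_\<beta>' = assms(14) and growth = assms(15)
    and saddle = assms(19)
  have x: "\<And>t. t \<ge> t0 \<Longrightarrow> (x has_vector_derivative x' t) (at t within {t0..})"
      "\<And>t. t \<ge> t0 \<Longrightarrow> (x' has_vector_derivative x'' t) (at t within {t0..})"
      "continuous_on {t0..} x''"
    and l: "\<And>t. t \<ge> t0 \<Longrightarrow> (l has_vector_derivative l' t) (at t within {t0..})"
      "\<And>t. t \<ge> t0 \<Longrightarrow> (l' has_vector_derivative l'' t) (at t within {t0..})"
      "continuous_on {t0..} l''"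
    using assms(18) by (auto simp: global_solution_def C2_from_def)
  have ode: "AE t in lebesgue_on {t0..}.
        x'' t + \<alpha> *\<^sub>R x' t =
          - (\<beta> t *\<^sub>R (gf (x t) + adjoint A (l t + (\<delta> * t powr s) *\<^sub>R l' t)
                     + \<sigma> *\<^sub>R adjoint A (A (x t) - b))) + \<epsilon> t \<and>
        l'' t + \<alpha> *\<^sub>R l' t =
          \<beta> t *\<^sub>R (A (x t + (\<delta> * t powr s) *\<^sub>R x' t) - b)"
    using assms(18) by (simp add: global_solution_def)
  have at: "at t within {t0..} = at t" if "t > t0" for t
    by (rule at_within_nhd[of t "{t0<..}"]) (use that in auto)
  have cont: "continuous_on {t0..} x" "continuous_on {t0..} x'" "continuous_on {t0..} l"
      "continuous_on {t0..} l'"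
    by (rule continuous_on_vector_derivative, use x l in force)+
  have cont_\<beta>: "continuous_on {t0..} \<beta>"
    using d\<beta> by (intro DERIV_continuous_on) auto
  have cont_powr: "continuous_on {t0..} (\<lambda>t. t powr r)" for r
    using t0 by (intro continuous_intros) auto
  have contA: "continuous_on S g \<Longrightarrow> continuous_on S (\<lambda>t. A (g t))" for S :: "real set" and g
    by (rule bounded_linear.continuous_on[OF A])
  have contadj: "continuous_on S g \<Longrightarrow> continuous_on S (\<lambda>t. adjoint A (g t))" for S :: "real set" and g
    by (rule bounded_linear.continuous_on[OF bounded_linear_adjoint_hilbert[OF A]])
  have contgf: "continuous_on S g \<Longrightarrow> continuous_on S (\<lambda>t. gf (g t))" for S :: "real set" and g
    by (rule continuous_on_compose2[OF cont_gf]) auto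
  have cont_f: "continuous_on UNIV f"
    using gf unfolding gderiv_def
    by (intro continuous_at_imp_continuous_on) (blast intro: has_derivative_continuous)
  have contf: "continuous_on S g \<Longrightarrow> continuous_on S (\<lambda>t. f (g t))" for S :: "real set" and g
    by (rule continuous_on_compose2[OF cont_f]) auto
  note cont_rules = cont x(3) l(3) cont_\<beta> cont_\<beta>' cont_powr contA contadj contgf contf continuous_intros

  \<comment> \<open>Continuous form of the equations\<close>
  define \<theta> where "\<theta> t = \<delta> * t powr s" for t
  \<comment> \<open>\<open>e\<close> is a continuous representative of \<open>\<epsilon>\<close>; with it the first equation holds everywhere, so
    the energy is differentiable everywhere.\<close>
  define e where "e t = x'' t + \<alpha> *\<^sub>R x' t + \<beta> t *\<^sub>R (gf (x t) + adjoint A (l t + \<theta> t *\<^sub>R l' t)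
    + \<sigma> *\<^sub>R adjoint A (A (x t) - b))" for t
  have cont_e: "continuous_on {t0..} e"
    unfolding e_def \<theta>_def by (intro cont_rules)
  have e_eq: "AE t in lebesgue_on {t0..}. e t = \<epsilon> t"
    using ode by eventually_elim (simp add: e_def \<theta>_def)
  have "(\<lambda>t. t powr (s / 2) * norm (e t)) absolutely_integrable_on {t0..}"
    by (rule absolutely_integrable_cong_AE[OF assms(17)]) (use e_eq in eventually_elim, simp)
  then have int_e: "(\<lambda>t. t powr (s / 2) * norm (e t)) integrable_on {a..}" if "t0 \<le> a" for a
    using that set_integrable_subset[of lebesgue "{t0..}" _ "{a..}"]
    by (intro set_lebesgue_integral_eq_integral(1)) auto
  have eq_x: "x'' t + \<alpha> *\<^sub>R x' t = - (\<beta> t *\<^sub>R (gf (x t) + adjoint A (l t + \<theta> t *\<^sub>R l' t)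
    + \<sigma> *\<^sub>R adjoint A (A (x t) - b))) + e t" for t
    by (simp add: e_def)
  \<comment> \<open>The second equation carries no perturbation, so its residual is continuous and
    vanishes at every time after \<open>t0\<close>.\<close>
  have "l'' t + \<alpha> *\<^sub>R l' t - \<beta> t *\<^sub>R (A (x t + \<theta> t *\<^sub>R x' t) - b) = 0" if "t > t0" for t
  proof (rule continuous_AE_zero_halfline[OF _ _ that])
    show "continuous_on {t0..} (\<lambda>t. l'' t + \<alpha> *\<^sub>R l' t - \<beta> t *\<^sub>R (A (x t + \<theta> t *\<^sub>R x' t) - b))"
      unfolding \<theta>_def by (intro cont_rules)
    show "AE t in lebesgue_on {t0..}.
        l'' t + \<alpha> *\<^sub>R l' t - \<beta> t *\<^sub>R (A (x t + \<theta> t *\<^sub>R x' t) - b) = 0"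
      using ode by eventually_elim (simp add: \<theta>_def)
  qed
  then have eq_l: "l'' t + \<alpha> *\<^sub>R l' t = \<beta> t *\<^sub>R (A (x t + \<theta> t *\<^sub>R x' t) - b)" if "t > t0" for t
    using that by simp

  have feas: "A xs = b" by (rule saddle_point_feasible[OF saddle])
  define L where "L t = Lagrangian f A b (x t) ls - Lagrangian f A b xs ls" for t
  define F where "F t = aug_Lagrangian \<sigma> f A b (x t) ls - aug_Lagrangian \<sigma> f A b xs ls" for t
  define w where "w t = (x t - xs, l t - ls)" for t
  define w' where "w' t = (x' t, l' t)" for t
  have L: "0 \<le> L t" for t
    using saddle by (simp add: L_def saddle_points_def)
  have F: "F t = L t + \<sigma> / 2 * (norm (A (x t) - b))\<^sup>2" for t
    by (simp add: F_def L_def aug_Lagrangian_def feas)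
  have F0: "0 \<le> F t" for t
    using L[of t] \<sigma> by (simp add: F)
  have cont_F: "continuous_on {t0..} F"
    unfolding F_def aug_Lagrangian_def Lagrangian_def by (intro cont_rules)
  have norm_w': "(norm (w' t))\<^sup>2 = (norm (x' t))\<^sup>2 + (norm (l' t))\<^sup>2" for t
    by (simp add: w'_def power2_norm_eq_inner)
  \<comment> \<open>\<open>\<delta> * H\<close> equals \<open>\<beta>\<close> minus the derivative
    of \<open>\<theta> * \<beta>\<close>; the growth condition on \<open>\<beta>\<close> says
    exactly that this coefficient of the gap is nonnegative.\<close>
  define H where "H t = (1 / \<delta> - s * t powr (s - 1)) * \<beta> t - t powr s * \<beta>' t" for t
  have H0: "0 \<le> H t" if "t \<ge> t0" for t
    using growth[OF that] by (simp add: H_def)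
  have cont_H: "continuous_on {t0..} H"
    unfolding H_def by (intro cont_rules)

  \<comment> \<open>Coercivity and dissipation of the energy\<close>
  obtain c t1 where c: "0 < c" "c < \<alpha>" and t1: "1 \<le> t1" "t0 < t1"
    and damp: "\<And>t. t \<ge> t1 \<Longrightarrow> 1 + \<delta> * (s * t powr (s - 1)) / 2 \<le> (\<alpha> - c) * \<theta> t"
    using overdamped_eventually[OF \<alpha> \<delta> assms(9,10)] unfolding \<theta>_def by metis
  define E where "E t = \<theta> t * (\<beta> t * F t) + w' t \<bullet> w t + \<theta> t / 2 * (norm (w' t))\<^sup>2
        + \<alpha> / 2 * (norm (w t))\<^sup>2" for t
  define D where "D t = \<delta> * (H t * F t) + \<sigma> / 2 * (\<beta> t * (norm (A (x t) - b))\<^sup>2)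
    + c * \<delta> * (t powr s * (norm (w' t))\<^sup>2)" for t
  \<comment> \<open>\<open>C\<close> is the sum of the four coefficients in
    \<open>1 + 4 / c * E + \<delta> + 4 * \<alpha> / c * E\<close>, the bound found below for the
    perturbation's test vector after division by \<open>t powr (s / 2)\<close>.\<close>
  define C where "C = 1 + \<delta> + 4 / c + 4 * \<alpha> / c"
  define k where "k t = C * (t powr (s / 2) * norm (e t))" for t
  have C: "0 \<le> C" using c \<alpha> \<delta> by (simp add: C_def)
  have E_ge: "\<theta> t * (\<beta> t * F t) + c / 4 * (norm (w t))\<^sup>2 + c / (4 * \<alpha>) * (\<theta> t * (norm (w' t))\<^sup>2) \<le> E t"
    if "t \<ge> t1" for t
  proof -
    have "0 \<le> \<delta> * (s * t powr (s - 1)) / 2" using \<delta> assms(9) by simp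
    then have "1 \<le> (\<alpha> - c) * \<theta> t" using damp[OF that] by linarith
    from quadratic_coercive[OF c this, of "norm (w t)" "norm (w' t)"]
    have "c / 4 * (norm (w t))\<^sup>2 + c / (4 * \<alpha>) * (\<theta> t * (norm (w' t))\<^sup>2)
      \<le> \<theta> t / 2 * (norm (w' t))\<^sup>2 - norm (w t) * norm (w' t) + \<alpha> / 2 * (norm (w t))\<^sup>2" .
    moreover have "- (norm (w t) * norm (w' t)) \<le> w' t \<bullet> w t"
      using Cauchy_Schwarz_ineq2[of "w' t" "w t"] by (simp add: mult.commute)
    ultimately show ?thesis unfolding E_def by linarith
  qed
  have \<theta>0: "0 \<le> \<theta> t" for t using \<delta> by (simp add: \<theta>_def)
  have parts0: "0 \<le> \<theta> t * (\<beta> t * F t)" "0 \<le> c / 4 * (norm (w t))\<^sup>2"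
      "0 \<le> c / (4 * \<alpha>) * (\<theta> t * (norm (w' t))\<^sup>2)" if "t \<ge> t1" for t
    using that t1 \<beta>[of t] F0[of t] \<theta>0[of t] c \<alpha> by auto
  have E0: "0 \<le> E t" if "t \<ge> t1" for t
    using E_ge[OF that] parts0[OF that] by linarith
  \<comment> \<open>Coercivity bounds squares, and \<open>r \<le> 1 + r^2\<close> passes from
    lengths to squares. In \<open>\<theta> * norm x'\<close> one factor
    \<open>t powr (s / 2)\<close> stays with the perturbation as its integrable weight, and the
    other is absorbed into \<open>\<theta> * norm w' ^ 2\<close>.\<close>
  have pert: "e t \<bullet> (x t - xs + \<theta> t *\<^sub>R x' t) \<le> k t * (1 + E t)" if "t \<ge> t1" for t
  proof -
    have t: "1 \<le> t" using that t1 by simp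
    have le_square: "r \<le> 1 + r\<^sup>2" for r :: real
      using zero_le_power2[of "r - 1 / 2"] by (simp add: power2_eq_square algebra_simps)
    have powr: "1 \<le> t powr (s / 2)"
      using t assms(9) by (simp add: ge_one_powr_ge_zero)
    have powr_sq: "(t powr (s / 2))\<^sup>2 = t powr s"
      using t by (simp add: power2_eq_square powr_add[symmetric])
    have E_parts: "c / 4 * (norm (w t))\<^sup>2 \<le> E t" "c / (4 * \<alpha>) * (\<theta> t * (norm (w' t))\<^sup>2) \<le> E t"
      using E_ge[OF that] parts0[OF that] by linarith+
    have "norm (x t - xs) \<le> norm (w t)" "norm (x' t) \<le> norm (w' t)"
      unfolding w_def w'_def by (metis norm_fst_le fst_conv)+
    then have "norm (x t - xs) \<le> 1 + (norm (w t))\<^sup>2" "norm (x' t) \<le> norm (w' t)"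
      using le_square[of "norm (w t)"] by linarith+
    moreover have "(norm (w t))\<^sup>2 \<le> 4 / c * E t"
      using E_parts(1) c by (simp add: field_simps)
    ultimately have n1: "norm (x t - xs) \<le> t powr (s / 2) * (1 + 4 / c * E t)"
      using mult_right_mono[OF powr, of "1 + 4 / c * E t"] E0[OF that] c by auto
    have "\<theta> t * norm (x' t) \<le> \<theta> t * norm (w' t)"
      using \<theta>0[of t] \<open>norm (x' t) \<le> norm (w' t)\<close> by (rule mult_left_mono[rotated])
    also have "\<dots> = t powr (s / 2) * (\<delta> * (t powr (s / 2) * norm (w' t)))"
      unfolding \<theta>_def powr_sq[symmetric] by (simp add: power2_eq_square)
    also have "\<dots> \<le> t powr (s / 2) * (\<delta> * (1 + (t powr (s / 2) * norm (w' t))\<^sup>2))"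
      using \<delta> by (intro mult_left_mono le_square) auto
    also have "\<dots> = t powr (s / 2) * (\<delta> + \<theta> t * (norm (w' t))\<^sup>2)"
      unfolding power_mult_distrib powr_sq \<theta>_def by (simp add: algebra_simps)
    also have "\<dots> \<le> t powr (s / 2) * (\<delta> + 4 * \<alpha> / c * E t)"
      using E_parts(2) c \<alpha> by (intro mult_left_mono add_left_mono) (auto simp: field_simps)
    finally have n2: "\<theta> t * norm (x' t) \<le> t powr (s / 2) * (\<delta> + 4 * \<alpha> / c * E t)" .
    have "norm (x t - xs + \<theta> t *\<^sub>R x' t) \<le> norm (x t - xs) + \<theta> t * norm (x' t)"
      using norm_triangle_ineq[of "x t - xs" "\<theta> t *\<^sub>R x' t"] \<theta>0[of t] by simp
    then have "e t \<bullet> (x t - xs + \<theta> t *\<^sub>R x' t) \<le> norm (e t) * (norm (x t - xs) + \<theta> t * norm (x' t))"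
      by (rule order_trans[OF norm_cauchy_schwarz mult_left_mono]) simp
    also have "\<dots> \<le> norm (e t) * (t powr (s / 2) * (C * (1 + E t)))"
    proof (rule mult_left_mono)
      have "1 + 4 / c * E t + (\<delta> + 4 * \<alpha> / c * E t) \<le> C * (1 + E t)"
      proof -
        have "0 \<le> E t + \<delta> * E t + 4 / c + 4 * \<alpha> / c" using E0[OF that] c \<alpha> \<delta> by simp
        then show ?thesis unfolding C_def by (simp add: algebra_simps add_divide_distrib)
      qed
      from mult_left_mono[OF this powr_ge_zero[of t "s / 2"]]
      show "norm (x t - xs) + \<theta> t * norm (x' t) \<le> t powr (s / 2) * (C * (1 + E t))"
        using n1 n2 by (simp add: distrib_left)
    qed simp
    finally show ?thesis by (simp add: k_def mult_ac)
  qed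
  have "\<exists>E'. (E has_real_derivative E') (at t) \<and> E' \<le> k t * (1 + E t) - D t" if "t \<ge> t1" for t
  proof -
    have t: "t > t0" "t > 0" using that t1 t0 by auto
    have d\<theta>: "(\<theta> has_real_derivative \<delta> * (s * t powr (s - 1))) (at t)"
      unfolding \<theta>_def using t by (auto intro!: derivative_eq_intros simp: powr_diff)
    obtain E' where E': "(E has_real_derivative E') (at t)"
      "E' \<le> e t \<bullet> (x t - xs + \<theta> t *\<^sub>R x' t)
        - (\<beta> t - (\<delta> * (s * t powr (s - 1)) * \<beta> t + \<theta> t * \<beta>' t)) * F t
        - \<sigma> / 2 * (\<beta> t * (norm (A (x t) - b))\<^sup>2)
        - (\<alpha> * \<theta> t - (1 + \<delta> * (s * t powr (s - 1)) / 2)) * (norm (w' t))\<^sup>2"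
      using energy_dissipation[where x = x and x' = x' and l = l and l' = l' and ls = ls and t = t,
          OF A f gf feas x(1)[of t, unfolded at[OF t(1)]] x(2)[of t, unfolded at[OF t(1)]]
          l(1)[of t, unfolded at[OF t(1)]] l(2)[of t, unfolded at[OF t(1)]]
          d\<theta> d\<beta>[of t, unfolded at[OF t(1)]] _ eq_x[of t] eq_l[OF t(1)]]
        \<beta>[of t] t
      unfolding E_def[abs_def] F_def w_def w'_def by force
    have "\<beta> t - (\<delta> * (s * t powr (s - 1)) * \<beta> t + \<theta> t * \<beta>' t) = \<delta> * H t"
      using \<delta> by (simp add: H_def \<theta>_def algebra_simps)
    moreover have "c * \<theta> t * (norm (w' t))\<^sup>2
        \<le> (\<alpha> * \<theta> t - (1 + \<delta> * (s * t powr (s - 1)) / 2)) * (norm (w' t))\<^sup>2"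
      using damp[OF that] by (intro mult_right_mono) (auto simp: algebra_simps)
    ultimately have "E' \<le> k t * (1 + E t) - D t"
      using E'(2) pert[OF that] by (simp add: D_def \<theta>_def mult.assoc)
    with E'(1) show ?thesis by blast
  qed
  then obtain E' where E': "\<And>t. t \<ge> t1 \<Longrightarrow> (E has_real_derivative E' t) (at t)"
      "\<And>t. t \<ge> t1 \<Longrightarrow> E' t \<le> k t * (1 + E t) - D t"
    by metis
  have D_parts: "0 \<le> H t * F t" "0 \<le> \<beta> t * (norm (A (x t) - b))\<^sup>2"
      "0 \<le> t powr s * (norm (w' t))\<^sup>2" if "t \<ge> t0" for t
    using H0[OF that] F0[of t] \<beta>[OF that] by auto
  have D_ge: "\<delta> * (H t * F t) \<le> D t" "\<sigma> / 2 * (\<beta> t * (norm (A (x t) - b))\<^sup>2) \<le> D t"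
      "c * \<delta> * (t powr s * (norm (w' t))\<^sup>2) \<le> D t" "0 \<le> D t" if "t \<ge> t1" for t
  proof -
    have "0 \<le> \<delta> * (H t * F t)" "0 \<le> \<sigma> / 2 * (\<beta> t * (norm (A (x t) - b))\<^sup>2)"
        "0 \<le> c * \<delta> * (t powr s * (norm (w' t))\<^sup>2)"
      using D_parts[of t] that t1 \<delta> \<sigma> c by (auto simp del: zero_le_mult_iff intro!: mult_nonneg_nonneg)
    then show "\<delta> * (H t * F t) \<le> D t" "\<sigma> / 2 * (\<beta> t * (norm (A (x t) - b))\<^sup>2) \<le> D t"
      "c * \<delta> * (t powr s * (norm (w' t))\<^sup>2) \<le> D t" "0 \<le> D t"
      unfolding D_def by linarith+
  qed
  have cont_parts: "continuous_on {t0..} (\<lambda>t. H t * F t)"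
      "continuous_on {t0..} (\<lambda>t. \<beta> t * (norm (A (x t) - b))\<^sup>2)"
      "continuous_on {t0..} (\<lambda>t. t powr s * (norm (w' t))\<^sup>2)"
    unfolding w'_def by (intro cont_rules cont_H cont_F)+
  have cont_D: "continuous_on {t1..} D"
  proof (rule continuous_on_subset)
    show "continuous_on {t0..} D"
      unfolding D_def by (intro continuous_on_add continuous_on_mult_left cont_parts)
  qed (use t1 in auto)
  have cont_k: "continuous_on {t1..} k"
  proof (rule continuous_on_subset)
    show "continuous_on {t0..} k"
      unfolding k_def by (intro cont_rules cont_e)
  qed (use t1 in auto)
  have int_k: "k integrable_on {t1..}"
    unfolding k_def using integrable_on_cmult_left[OF int_e[of t1], of C] t1 by simp
  have k0: "0 \<le> k t" for t using C by (simp add: k_def)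
  obtain M where M: "\<And>t. t \<ge> t1 \<Longrightarrow> E t \<le> M" "\<And>t. t \<ge> t1 \<Longrightarrow> integral {t1..t} D \<le> M"
    using energy_bound[OF E'(1) E0 cont_k k0 int_k cont_D D_ge(4) E'(2)] by metis
  have M_ge: "\<theta> t * (\<beta> t * F t) \<le> M" "c / 4 * (norm (w t))\<^sup>2 \<le> M"
      "c / (4 * \<alpha>) * (\<theta> t * (norm (w' t))\<^sup>2) \<le> M" if "t \<ge> t1" for t
    using M(1)[OF that] E_ge[OF that] parts0[OF that] by linarith+
  have M0: "0 \<le> M" using M(1)[of t1] E0[of t1] by simp

  \<comment> \<open>Boundedness, integrability and rates\<close>
  have "bounded ((\<lambda>t. (x t, l t)) ` {t0..})"
  proof -
    \<comment> \<open>The energy bound starts at \<open>t1\<close>; before that, continuity on a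
      compact interval is used.\<close>
    have "compact ((\<lambda>t. (x t, l t)) ` {t0..t1})"
      by (intro compact_continuous_image continuous_on_Pair continuous_on_subset[OF cont(1)]
          continuous_on_subset[OF cont(3)]) auto
    then have "bounded ((\<lambda>t. (x t, l t)) ` {t0..t1})" by (rule compact_imp_bounded)
    moreover have "bounded ((\<lambda>t. (x t, l t)) ` {t1..})"
    proof (rule boundedI)
      fix z assume "z \<in> (\<lambda>t. (x t, l t)) ` {t1..}"
      then obtain t where t: "t \<ge> t1" "z = w t + (xs, ls)" by (auto simp: w_def)
      have "norm (w t) \<le> sqrt (4 * M / c)"
        using M_ge(2)[OF t(1)] c by (intro real_le_rsqrt) (simp add: field_simps)
      then show "norm z \<le> sqrt (4 * M / c) + norm (xs, ls)"
        unfolding t(2) using norm_triangle_ineq[of "w t" "(xs, ls)"] by linarith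
    qed
    moreover have "{t0..} = {t0..t1} \<union> {t1..}" using t1 by auto
    ultimately show ?thesis by (simp add: image_Un)
  qed
  moreover have "(\<lambda>t. H t * F t) absolutely_integrable_on {t0..}"
    using D_parts(1) M(2) D_ge(1) t1 \<delta>
    by (intro integrable_halfline_dominated_tail[OF cont_parts(1) _ cont_D, where C = \<delta>]) auto
  moreover have "(\<lambda>t. t powr s * ((norm (x' t))\<^sup>2 + (norm (l' t))\<^sup>2)) absolutely_integrable_on {t0..}"
    unfolding norm_w'[symmetric] using D_parts(3) M(2) D_ge(3) t1 \<delta> c
    by (intro integrable_halfline_dominated_tail[OF cont_parts(3) _ cont_D, where C = "c * \<delta>"]) auto
  moreover have "(\<lambda>t. \<beta> t * (norm (A (x t) - b))\<^sup>2) absolutely_integrable_on {t0..}"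
    using D_parts(2) M(2) D_ge(2) t1 \<sigma>
    by (intro integrable_halfline_dominated_tail[OF cont_parts(2) _ cont_D, where C = "\<sigma> / 2"]) auto
  moreover have "(\<lambda>t. norm (x' t) + norm (l' t)) \<in> O[at_top](\<lambda>t. 1 / t powr (s / 2))"
  \<comment> \<open>The root comes from
    \<open>c / (4 * \<alpha>) * (\<theta> * norm w' ^ 2) \<le> M\<close>, and the factor 2 from
    bounding each velocity component by \<open>norm w'\<close>.\<close>
  proof (rule bigoI)
    show "\<forall>\<^sub>F t in at_top. norm (norm (x' t) + norm (l' t))
        \<le> 2 * sqrt (4 * \<alpha> * M / (c * \<delta>)) * norm (1 / t powr (s / 2))"
      using eventually_ge_at_top[of t1]
    proof eventually_elim
      case (elim t)
      then have "t > 0" using t1 by simp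
      then have "(t powr (s / 2) * norm (w' t))\<^sup>2 = t powr s * (norm (w' t))\<^sup>2"
        by (simp add: power_mult_distrib power2_eq_square powr_add[symmetric])
      also have "\<dots> \<le> 4 * \<alpha> * M / (c * \<delta>)"
        using M_ge(3)[OF elim] c \<alpha> \<delta> by (simp add: \<theta>_def field_simps)
      finally have "t powr (s / 2) * norm (w' t) \<le> sqrt (4 * \<alpha> * M / (c * \<delta>))"
        by (rule real_le_rsqrt)
      then have "norm (w' t) \<le> sqrt (4 * \<alpha> * M / (c * \<delta>)) * (1 / t powr (s / 2))"
        using \<open>t > 0\<close> by (simp add: field_simps)
      moreover have "norm (x' t) \<le> norm (w' t)" "norm (l' t) \<le> norm (w' t)"
        unfolding w'_def by (metis norm_fst_le norm_snd_le fst_conv snd_conv)+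
      ultimately show ?case by simp
    qed
  qed
  moreover have F_le: "F t \<le> M / \<delta> * (1 / (t powr s * \<beta> t))" if "t \<ge> t1" for t
    using M_ge(1)[OF that] \<delta> \<beta>[of t] that t1 by (simp add: \<theta>_def field_simps)
  have "L \<in> O[at_top](\<lambda>t. 1 / (t powr s * \<beta> t))"
  \<comment> \<open>The Lagrangian gap lies between 0 and the augmented gap
    \<open>F\<close>.\<close>
  proof (rule bigoI)
    show "\<forall>\<^sub>F t in at_top. norm (L t) \<le> M / \<delta> * norm (1 / (t powr s * \<beta> t))"
      using eventually_ge_at_top[of t1]
    proof eventually_elim
      case (elim t)
      have "L t \<le> F t" using \<sigma> by (simp add: F)
      then show ?case
        using F_le[OF elim] L[of t] \<beta>[of t] elim t1 by simp
    qed
  qed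
  moreover have "(\<lambda>t. norm (A (x t) - b)) \<in> O[at_top](\<lambda>t. 1 / (t powr (s / 2) * sqrt (\<beta> t)))"
  \<comment> \<open>As \<open>L\<close> is nonnegative, the penalty alone is bounded by
    \<open>F\<close>, and a square root halves the decay exponent.\<close>
  proof (rule bigoI)
    show "\<forall>\<^sub>F t in at_top. norm (norm (A (x t) - b))
        \<le> sqrt (2 * M / (\<sigma> * \<delta>)) * norm (1 / (t powr (s / 2) * sqrt (\<beta> t)))"
      using eventually_ge_at_top[of t1]
    proof eventually_elim
      case (elim t)
      then have t: "t > 0" "\<beta> t > 0" using t1 \<beta>[of t] by auto
      have "\<sigma> / 2 * (norm (A (x t) - b))\<^sup>2 \<le> M / \<delta> * (1 / (t powr s * \<beta> t))"
        using F_le[OF elim] L[of t] unfolding F by linarith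
      then have "(norm (A (x t) - b))\<^sup>2 * (t powr s * \<beta> t) \<le> 2 * M / (\<sigma> * \<delta>)"
        using t \<sigma> \<delta> by (simp add: field_simps)
      moreover have "(norm (A (x t) - b) * (t powr (s / 2) * sqrt (\<beta> t)))\<^sup>2
          = (norm (A (x t) - b))\<^sup>2 * (t powr s * \<beta> t)"
        using t by (simp add: power_mult_distrib power2_eq_square[of "_ powr _"] powr_add[symmetric])
      ultimately have "norm (A (x t) - b) * (t powr (s / 2) * sqrt (\<beta> t)) \<le> sqrt (2 * M / (\<sigma> * \<delta>))"
        by (intro real_le_rsqrt) simp
      then show ?case
        using t by (simp add: field_simps)
    qed
  qed
  ultimately show ?thesis
    unfolding H_def F_def L_def[abs_def] by blast
qed

end
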